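(* Let $S$ be a commutative semiring and let $I$ be a $g$-closed ideal of $S$ satisfying the maximal-ideal lifting hypothesis. Let $J$ be an $I$-saturated ideal of $S$. Then $\pi_I(J)$ is a $z$-ideal of $S_I=S/\wp_I$ if and only if $J$ is an $I$-relative $z$-ideal of $S$.
   Context: A semiring here is commutative with $0$ and $1$: $(S,+,0)$ and $(S,\cdot,1)$ are commutative monoids, multiplication distributes over addition, and $0s=0$. An ideal is a non-empty subset closed under addition and under multiplication by arbitrary elements; maximal ideals are proper. $\mathrm{Max}(S)$ is the set of maximal ideals and $\mathcal M(a)=\{M\in\mathrm{Max}(S)\mid a\in M\}$. An ideal $K$ of a semiring is a $z$-ideal if $a\in K$ and $\mathcal M(a)=\mathcal M(b)$ imply $b\in K$ (hulls taken in that semiring). A congruence is an equivalence relation on $S$ compatible with $+$ and $\cdot$; maximal congruences are maximal among proper ones (those $\neq S\times S$). The zero-class of $\theta$ is $0_\theta=\{a\mid(a,0)\in\theta\}$. For an ideal $I$, $\wp_I$ is the intersection of all maximal congruences $\theta$ with $I\subseteq 0_\theta$ (equal to $S\times S$ if there are none), $I^g=0_{\wp_I}$, and $I$ is $g$-closed if $I=I^g$. Let $\pi_I:S\to S_I:=S/\wp_I$ be the quotient homomorphism and $[a]_I=\pi_I(a)$. An ideal $J$ of $S$ is $I$-saturated if $I^g\subseteq J$ and $(a,b)\in\wp_I$ together with $a\in J$ imply $b\in J$; equivalently $J=\pi_I^{-1}(\pi_I(J))$. Put $\mathcal V_{\max}(I)=\{M\in\mathrm{Max}(S)\mid I\subseteq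 M\}$. A $g$-closed ideal $I$ satisfies the maximal-ideal lifting hypothesis if every maximal ideal of $S_I$ is of the form $\pi_I(M)$ for a unique $M\in\mathcal V_{\max}(I)$, and membership is detected by $[a]_I\in\pi_I(M)\Leftrightarrow a\in M$ for all $a\in S$ and all $M\in\mathcal V_{\max}(I)$. An ideal $J$ of $S$ is an $I$-relative $z$-ideal if $a\in J$, $b\in S$ and $\mathcal M(a)\cap\mathcal V_{\max}(I)=\mathcal M(b)\cap\mathcal V_{\max}(I)$ imply $b\in J$. *)

theory Defs
  imports "HOL-Algebra.Ring"
begin

text \<open>
  Commutative semirings are carrier-based records, since the quotient \<open>S/\<wp>\<^sub>I\<close> has to be a semiring
  in its own right. Neither \<open>\<zero> \<noteq> \<one>\<close> nor additive cancellation is assumed.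
\<close>

locale csemiring = semiring R + comm_monoid R for R (structure)

subsection \<open>Ideals\<close>

text \<open>The locale \<open>ideal\<close> of HOL-Algebra requires a ring, so ideals are defined here for semirings.\<close>

definition sr_ideal :: "'a set \<Rightarrow> ('a, 'm) ring_scheme \<Rightarrow> bool" where
  "sr_ideal I S \<longleftrightarrow> I \<subseteq> carrier S \<and> I \<noteq> {}
     \<and> (\<forall>a\<in>I. \<forall>b\<in>I. a \<oplus>\<^bsub>S\<^esub> b \<in> I)
     \<and> (\<forall>s\<in>carrier S. \<forall>a\<in>I. s \<otimes>\<^bsub>S\<^esub> a \<in> I)"

definition max_ideal :: "'a set \<Rightarrow> ('a, 'm) ring_scheme \<Rightarrow> bool" where
  "max_ideal M S \<longleftrightarrow> sr_ideal M S \<and> M \<noteq> carrier S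
     \<and> (\<forall>J. sr_ideal J S \<and> M \<subseteq> J \<longrightarrow> J = M \<or> J = carrier S)"

definition Max_ideals :: "('a, 'm) ring_scheme \<Rightarrow> 'a set set" where
  "Max_ideals S = {M. max_ideal M S}"

definition hull :: "('a, 'm) ring_scheme \<Rightarrow> 'a \<Rightarrow> 'a set set" where
  "hull S a = {M \<in> Max_ideals S. a \<in> M}"

definition z_ideal :: "'a set \<Rightarrow> ('a, 'm) ring_scheme \<Rightarrow> bool" where
  "z_ideal K S \<longleftrightarrow> sr_ideal K S
     \<and> (\<forall>a\<in>K. \<forall>b\<in>carrier S. hull S a = hull S b \<longrightarrow> b \<in> K)"

definition V_max :: "('a, 'm) ring_scheme \<Rightarrow> 'a set \<Rightarrow> 'a set set" where
  "V_max S I = {M \<in> Max_ideals S. I \<subseteq> M}"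

definition rel_z_ideal :: "('a, 'm) ring_scheme \<Rightarrow> 'a set \<Rightarrow> 'a set \<Rightarrow> bool" where
  "rel_z_ideal S I J \<longleftrightarrow> sr_ideal J S
     \<and> (\<forall>a\<in>J. \<forall>b\<in>carrier S. hull S a \<inter> V_max S I = hull S b \<inter> V_max S I \<longrightarrow> b \<in> J)"

subsection \<open>Congruences and quotients\<close>

definition sr_congruence :: "('a \<times> 'a) set \<Rightarrow> ('a, 'm) ring_scheme \<Rightarrow> bool" where
  "sr_congruence \<theta> S \<longleftrightarrow> equiv (carrier S) \<theta>
     \<and> (\<forall>(a, b)\<in>\<theta>. \<forall>(c, d)\<in>\<theta>.
          (a \<oplus>\<^bsub>S\<^esub> c, b \<oplus>\<^bsub>S\<^esub> d) \<in> \<theta> \<and> (a \<otimes>\<^bsub>S\<^esub> c, b \<otimes>\<^bsub>S\<^esub> d) \<in> \<theta>)"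

definition max_congruence :: "('a \<times> 'a) set \<Rightarrow> ('a, 'm) ring_scheme \<Rightarrow> bool" where
  "max_congruence \<theta> S \<longleftrightarrow> sr_congruence \<theta> S \<and> \<theta> \<noteq> carrier S \<times> carrier S
     \<and> (\<forall>\<rho>. sr_congruence \<rho> S \<and> \<theta> \<subseteq> \<rho> \<longrightarrow> \<rho> = \<theta> \<or> \<rho> = carrier S \<times> carrier S)"

definition cong_zero_class :: "('a, 'm) ring_scheme \<Rightarrow> ('a \<times> 'a) set \<Rightarrow> 'a set" where
  "cong_zero_class S \<theta> = {a \<in> carrier S. (a, \<zero>\<^bsub>S\<^esub>) \<in> \<theta>}"

text \<open>
  Intersecting with \<open>carrier S \<times> carrier S\<close> only matters when the family of maximal congruences is
  empty; the result is then \<open>carrier S \<times> carrier S\<close>.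
\<close>

definition wp :: "('a, 'm) ring_scheme \<Rightarrow> 'a set \<Rightarrow> ('a \<times> 'a) set" where
  "wp S I = (carrier S \<times> carrier S) \<inter> \<Inter>{\<theta>. max_congruence \<theta> S \<and> I \<subseteq> cong_zero_class S \<theta>}"

definition g_closure :: "('a, 'm) ring_scheme \<Rightarrow> 'a set \<Rightarrow> 'a set" where
  "g_closure S I = cong_zero_class S (wp S I)"

definition g_closed :: "('a, 'm) ring_scheme \<Rightarrow> 'a set \<Rightarrow> bool" where
  "g_closed S I \<longleftrightarrow> I = g_closure S I"

text \<open>
  The operations follow the library pattern for functions on equivalence classes: for a congruence
  the union ranges over copies of a single class (see \<open>quot_simps\<close> below).
\<close>

definition quot :: "('a, 'm) ring_scheme \<Rightarrow> ('a \<times> 'a) set \<Rightarrow> 'a set ring" where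
  "quot S \<theta> = \<lparr>carrier = carrier S // \<theta>,
     mult = (\<lambda>A B. \<Union>a\<in>A. \<Union>b\<in>B. \<theta> `` {a \<otimes>\<^bsub>S\<^esub> b}),
     one = \<theta> `` {\<one>\<^bsub>S\<^esub>},
     zero = \<theta> `` {\<zero>\<^bsub>S\<^esub>},
     add = (\<lambda>A B. \<Union>a\<in>A. \<Union>b\<in>B. \<theta> `` {a \<oplus>\<^bsub>S\<^esub> b})\<rparr>"

definition S_quot :: "('a, 'm) ring_scheme \<Rightarrow> 'a set \<Rightarrow> 'a set ring" where
  "S_quot S I = quot S (wp S I)"

definition pi_quot :: "('a, 'm) ring_scheme \<Rightarrow> 'a set \<Rightarrow> 'a \<Rightarrow> 'a set" where
  "pi_quot S I a = wp S I `` {a}"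

definition saturated :: "('a, 'm) ring_scheme \<Rightarrow> 'a set \<Rightarrow> 'a set \<Rightarrow> bool" where
  "saturated S I J \<longleftrightarrow> g_closure S I \<subseteq> J
     \<and> (\<forall>a b. (a, b) \<in> wp S I \<and> a \<in> J \<longrightarrow> b \<in> J)"

definition max_lifting :: "('a, 'm) ring_scheme \<Rightarrow> 'a set \<Rightarrow> bool" where
  "max_lifting S I \<longleftrightarrow>
     (\<forall>N \<in> Max_ideals (S_quot S I). \<exists>!M. M \<in> V_max S I \<and> N = pi_quot S I ` M)
     \<and> (\<forall>a \<in> carrier S. \<forall>M \<in> V_max S I. pi_quot S I a \<in> pi_quot S I ` M \<longleftrightarrow> a \<in> M)"

subsection \<open>The quotient is a commutative semiring\<close>

lemma sr_congruence_full: "csemiring S \<Longrightarrow> sr_congruence (carrier S \<times> carrier S) S"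
proof -
  assume "csemiring S"
  then interpret csemiring S .
  show ?thesis
    by (auto simp: sr_congruence_def equiv_def refl_on_def sym_def trans_def)
qed

lemma sr_congruence_wp:
  assumes "csemiring S" shows "sr_congruence (wp S I) S"
proof -
  let ?F = "{\<theta>. max_congruence \<theta> S \<and> I \<subseteq> cong_zero_class S \<theta>}"
  have F: "sr_congruence \<theta> S" if "\<theta> \<in> insert (carrier S \<times> carrier S) ?F" for \<theta>
    using that sr_congruence_full[OF assms] by (auto simp: max_congruence_def)
  have wp: "wp S I = \<Inter>(insert (carrier S \<times> carrier S) ?F)"
    by (simp add: wp_def)
  have E: "refl_on (carrier S) \<theta>" "sym \<theta>" "trans \<theta>"
    if "\<theta> \<in> insert (carrier S \<times> carrier S) ?F" for \<theta>
    using F[OF that] by (simp_all add: sr_congruence_def equiv_def)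
  have C: "(a \<oplus>\<^bsub>S\<^esub> c, b \<oplus>\<^bsub>S\<^esub> d) \<in> \<theta> \<and> (a \<otimes>\<^bsub>S\<^esub> c, b \<otimes>\<^bsub>S\<^esub> d) \<in> \<theta>"
    if "\<theta> \<in> insert (carrier S \<times> carrier S) ?F" "(a, b) \<in> \<theta>" "(c, d) \<in> \<theta>" for \<theta> a b c d
    using F[OF that(1)] that(2,3) by (auto simp: sr_congruence_def)
  have "equiv (carrier S) (wp S I)"
  proof (rule equivI)
    show "wp S I \<subseteq> carrier S \<times> carrier S" by (simp add: wp_def)
    show "refl_on (carrier S) (wp S I)"
      unfolding wp using E(1) by (simp add: refl_on_def)
    show "sym (wp S I)"
      unfolding wp using E(2) by (intro symI InterI) (meson InterD symD)
    show "trans (wp S I)"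
      unfolding wp using E(3) by (intro transI InterI) (meson InterD transD)
  qed
  moreover have "(a \<oplus>\<^bsub>S\<^esub> c, b \<oplus>\<^bsub>S\<^esub> d) \<in> wp S I \<and> (a \<otimes>\<^bsub>S\<^esub> c, b \<otimes>\<^bsub>S\<^esub> d) \<in> wp S I"
    if "(a, b) \<in> wp S I" "(c, d) \<in> wp S I" for a b c d
    using that C unfolding wp by (meson InterD InterI)
  ultimately show ?thesis unfolding sr_congruence_def by blast
qed

lemma quot_simps:
  assumes "sr_congruence \<theta> S" "a \<in> carrier S" "b \<in> carrier S"
  shows "\<theta> `` {a} \<otimes>\<^bsub>quot S \<theta>\<^esub> \<theta> `` {b} = \<theta> `` {a \<otimes>\<^bsub>S\<^esub> b}"
    and "\<theta> `` {a} \<oplus>\<^bsub>quot S \<theta>\<^esub> \<theta> `` {b} = \<theta> `` {a \<oplus>\<^bsub>S\<^esub> b}"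
proof -
  have e: "equiv (carrier S) \<theta>" using assms by (simp add: sr_congruence_def)
  have "(\<lambda>a b. \<theta> `` {a \<otimes>\<^bsub>S\<^esub> b}) respects2 \<theta>"
    using assms(1) equiv_class_eq[OF e] unfolding congruent2_def sr_congruence_def by blast
  then show "\<theta> `` {a} \<otimes>\<^bsub>quot S \<theta>\<^esub> \<theta> `` {b} = \<theta> `` {a \<otimes>\<^bsub>S\<^esub> b}"
    using UN_equiv_class2[OF e e _ assms(2,3)] by (simp add: quot_def)
  have "(\<lambda>a b. \<theta> `` {a \<oplus>\<^bsub>S\<^esub> b}) respects2 \<theta>"
    using assms(1) equiv_class_eq[OF e] unfolding congruent2_def sr_congruence_def by blast
  then show "\<theta> `` {a} \<oplus>\<^bsub>quot S \<theta>\<^esub> \<theta> `` {b} = \<theta> `` {a \<oplus>\<^bsub>S\<^esub> b}"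
    using UN_equiv_class2[OF e e _ assms(2,3)] by (simp add: quot_def)
qed

lemma csemiring_quot:
  fixes S (structure)
  assumes "csemiring S" "sr_congruence \<theta> S"
  shows "csemiring (quot S \<theta>)"
proof -
  interpret csemiring S by fact
  note q = quot_simps[OF assms(2)]
  have c: "carrier (quot S \<theta>) = (\<lambda>a. \<theta> `` {a}) ` carrier S"
    by (auto simp: quot_def quotient_def)
  have zo: "\<zero>\<^bsub>quot S \<theta>\<^esub> = \<theta> `` {\<zero>}" "\<one>\<^bsub>quot S \<theta>\<^esub> = \<theta> `` {\<one>}"
    by (simp_all add: quot_def)
  have "comm_monoid (add_monoid (quot S \<theta>))"
    by (rule comm_monoidI) (auto simp: c q zo a_ac)
  moreover have "comm_monoid (quot S \<theta>)"
    by (rule comm_monoidI) (auto simp: c q zo m_ac)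
  ultimately show ?thesis
    by (auto simp: csemiring_def semiring_def semiring_axioms_def abelian_monoid_def
        comm_monoid_def c q zo l_distr r_distr)
qed

lemma csemiring_S_quot: "csemiring S \<Longrightarrow> csemiring (S_quot S I)"
  by (simp add: S_quot_def csemiring_quot sr_congruence_wp)

lemma pi_quot_ring_hom:
  assumes "csemiring S"
  shows "pi_quot S I \<in> ring_hom S (S_quot S I)"
    and "pi_quot S I ` carrier S = carrier (S_quot S I)"
  using quot_simps[OF sr_congruence_wp[OF assms]]
  by (auto simp: ring_hom_def pi_quot_def S_quot_def quotient_def quot_def)

lemma saturated_iff:
  fixes S (structure)
  assumes "csemiring S" "sr_ideal J S"
  shows "saturated S I J \<longleftrightarrow> J = {a \<in> carrier S. pi_quot S I a \<in> pi_quot S I ` J}"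
proof -
  interpret csemiring S by fact
  have e: "equiv (carrier S) (wp S I)"
    using sr_congruence_wp[OF assms(1)] by (simp add: sr_congruence_def)
  have J: "J \<subseteq> carrier S" using assms(2) by (simp add: sr_ideal_def)
  obtain j where j: "j \<in> J" using assms(2) by (auto simp: sr_ideal_def)
  then have "\<zero> \<otimes> j \<in> J" using assms(2) zero_closed unfolding sr_ideal_def by blast
  with j J have z: "\<zero> \<in> J" by auto
  have pi: "pi_quot S I a = pi_quot S I b \<longleftrightarrow> (a, b) \<in> wp S I"
    if "a \<in> carrier S" "b \<in> carrier S" for a b
    using that eq_equiv_class_iff[OF e] by (simp add: pi_quot_def)
  have sub: "wp S I \<subseteq> carrier S \<times> carrier S" and sy: "sym (wp S I)"
    using e by (simp_all add: equiv_def)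
  have "saturated S I J \<longleftrightarrow> (\<forall>a b. (a, b) \<in> wp S I \<and> a \<in> J \<longrightarrow> b \<in> J)"
    using z sy by (auto simp: saturated_def g_closure_def cong_zero_class_def dest: symD)
  also have "\<dots> \<longleftrightarrow> J = {a \<in> carrier S. pi_quot S I a \<in> pi_quot S I ` J}"
  proof
    assume A: "\<forall>a b. (a, b) \<in> wp S I \<and> a \<in> J \<longrightarrow> b \<in> J"
    show "J = {a \<in> carrier S. pi_quot S I a \<in> pi_quot S I ` J}"
    proof (intro equalityI subsetI)
      fix a assume "a \<in> {a \<in> carrier S. pi_quot S I a \<in> pi_quot S I ` J}"
      then obtain b where "a \<in> carrier S" "b \<in> J" "pi_quot S I b = pi_quot S I a" by auto
      then show "a \<in> J" using A pi J by blast
    qed (use J in auto)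
  next
    assume A: "J = {a \<in> carrier S. pi_quot S I a \<in> pi_quot S I ` J}"
    show "\<forall>a b. (a, b) \<in> wp S I \<and> a \<in> J \<longrightarrow> b \<in> J"
    proof (intro allI impI)
      fix a b assume ab: "(a, b) \<in> wp S I \<and> a \<in> J"
      then have "b \<in> carrier S" "a \<in> carrier S" using sub by auto
      moreover have "pi_quot S I b = pi_quot S I a" using pi[OF calculation(2,1)] ab by simp
      ultimately have "b \<in> {a \<in> carrier S. pi_quot S I a \<in> pi_quot S I ` J}" using ab by auto
      then show "b \<in> J" using A by blast
    qed
  qed
  finally show ?thesis .
qed

end

(* The projection is surjective, so the preimage of an ideal is an ideal; together with the
   detection property this makes \<pi>(M) maximal for every M in V_max(I).  The lifting hypothesis then
   makes M \<mapsto> \<pi>(M) a bijection from V_max(I) onto Max(S_I) that carries the relative hull of a onto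
   the hull of [a], so equality of hulls in S_I is equality of relative hulls in S. *)
theory Submission
  imports Defs
begin

text \<open>Surjectivity writes every multiplier from \<open>R\<close> as some \<open>h s\<close>,
  so absorption in \<open>J\<close> carries over to the image.\<close>

lemma sr_ideal_image:
  assumes "h \<in> ring_hom S R" "h ` carrier S = carrier R" "sr_ideal J S"
  shows "sr_ideal (h ` J) R"
proof -
  have J: "J \<subseteq> carrier S" "J \<noteq> {}" "\<And>a b. a \<in> J \<Longrightarrow> b \<in> J \<Longrightarrow> a \<oplus>\<^bsub>S\<^esub> b \<in> J"
    "\<And>s a. s \<in> carrier S \<Longrightarrow> a \<in> J \<Longrightarrow> s \<otimes>\<^bsub>S\<^esub> a \<in> J"
    using assms(3) by (auto simp: sr_ideal_def)
  have "h a \<oplus>\<^bsub>R\<^esub> h b \<in> h ` J" if "a \<in> J" "b \<in> J" for a b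
    using that J(1,3) ring_hom_add[OF assms(1), of a b] by (metis image_eqI subsetD)
  moreover have "h s \<otimes>\<^bsub>R\<^esub> h a \<in> h ` J" if "s \<in> carrier S" "a \<in> J" for s a
    using that J(1,4) ring_hom_mult[OF assms(1), of s a] by (metis image_eqI subsetD)
  ultimately show ?thesis
    using J(1,2) unfolding sr_ideal_def assms(2)[symmetric] by blast
qed

lemma sr_ideal_preimage:
  assumes "csemiring S" "h \<in> ring_hom S R" "h ` carrier S = carrier R" "sr_ideal K R"
  shows "sr_ideal {a \<in> carrier S. h a \<in> K} S"
proof -
  interpret csemiring S by fact
  \<comment> \<open>Non-emptiness of the preimage rests on surjectivity: some element of
    \<open>K\<close> is hit by \<open>h\<close>.\<close>
  have "K \<subseteq> h ` carrier S" "K \<noteq> {}"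
    using assms(3,4) by (simp_all add: sr_ideal_def)
  then have "{a \<in> carrier S. h a \<in> K} \<noteq> {}" by blast
  moreover have "h a \<oplus>\<^bsub>R\<^esub> h b \<in> K" if "h a \<in> K" "h b \<in> K" for a b
    using that assms(4) by (simp add: sr_ideal_def)
  moreover have "h s \<otimes>\<^bsub>R\<^esub> h a \<in> K" if "s \<in> carrier S" "h a \<in> K" for s a
    using that assms(4) ring_hom_closed[OF assms(2)] by (simp add: sr_ideal_def)
  ultimately show ?thesis
    by (simp add: sr_ideal_def subset_iff ring_hom_add[OF assms(2)] ring_hom_mult[OF assms(2)])
qed

lemma max_ideal_image:
  assumes S: "csemiring S" and h: "h \<in> ring_hom S R" "h ` carrier S = carrier R"
    and M: "max_ideal M S" and detect: "\<And>a. a \<in> carrier S \<Longrightarrow> h a \<in> h ` M \<Longrightarrow> a \<in> M"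
  shows "max_ideal (h ` M) R"
  unfolding max_ideal_def
proof (intro conjI allI impI)
  have MS: "sr_ideal M S" "M \<subseteq> carrier S" "M \<noteq> carrier S"
    using M by (auto simp: max_ideal_def sr_ideal_def)
  show "sr_ideal (h ` M) R"
    using sr_ideal_image[OF h MS(1)] .
  \<comment> \<open>If the image were everything, \<open>detect\<close> would put every element of
    \<open>S\<close> into \<open>M\<close>.\<close>
  show "h ` M \<noteq> carrier R"
    using MS(2,3) detect h(2) by blast
  fix K assume K: "sr_ideal K R \<and> h ` M \<subseteq> K"
  let ?P = "{a \<in> carrier S. h a \<in> K}"
  have "K \<subseteq> h ` carrier S"
    using K h(2) by (auto simp: sr_ideal_def)
  \<comment> \<open>By surjectivity \<open>K\<close> is determined by its preimage, so the two cases
    for \<open>?P\<close> become the two cases for \<open>K\<close>.\<close>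
  then have hP: "h ` ?P = K" by blast
  have "sr_ideal ?P S" "M \<subseteq> ?P"
    using sr_ideal_preimage[OF S h] K MS(2) by auto
  then have "?P = M \<or> ?P = carrier S"
    using M by (simp add: max_ideal_def)
  then show "K = h ` M \<or> K = carrier R"
    using hP h(2) by metis
qed

lemma max_lifting_detect:
  assumes "max_lifting S I" "M \<in> V_max S I" "a \<in> carrier S"
  shows "pi_quot S I a \<in> pi_quot S I ` M \<longleftrightarrow> a \<in> M"
  using assms by (simp add: max_lifting_def)

text \<open>The lifting hypothesis provides one inclusion directly; the other follows from detection
  through \<open>max_ideal_image\<close>.\<close>

lemma Max_ideals_S_quot:
  assumes "csemiring S" "max_lifting S I"
  shows "Max_ideals (S_quot S I) = (`) (pi_quot S I) ` V_max S I"
proof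
  show "Max_ideals (S_quot S I) \<subseteq> (`) (pi_quot S I) ` V_max S I"
  proof
    fix N assume "N \<in> Max_ideals (S_quot S I)"
    then have "\<exists>!M. M \<in> V_max S I \<and> N = pi_quot S I ` M"
      using assms(2) by (simp add: max_lifting_def)
    then show "N \<in> (`) (pi_quot S I) ` V_max S I" by blast
  qed
  show "(`) (pi_quot S I) ` V_max S I \<subseteq> Max_ideals (S_quot S I)"
  proof (intro image_subsetI)
    fix M assume M: "M \<in> V_max S I"
    then have "max_ideal M S" by (simp add: V_max_def Max_ideals_def)
    then have "max_ideal (pi_quot S I ` M) (S_quot S I)"
      by (rule max_ideal_image[OF assms(1) pi_quot_ring_hom[OF assms(1)]])
        (simp add: max_lifting_detect[OF assms(2) M])
    then show "pi_quot S I ` M \<in> Max_ideals (S_quot S I)"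
      by (simp add: Max_ideals_def)
  qed
qed

text \<open>Detection recovers \<open>M\<close> from its image, as the set of those carrier elements
  whose class lies in it.\<close>

lemma inj_on_V_max:
  assumes "max_lifting S I"
  shows "inj_on ((`) (pi_quot S I)) (V_max S I)"
proof (rule inj_onI)
  fix M N assume MN: "M \<in> V_max S I" "N \<in> V_max S I" "pi_quot S I ` M = pi_quot S I ` N"
  then have "M \<subseteq> carrier S" "N \<subseteq> carrier S"
    by (auto simp: V_max_def Max_ideals_def max_ideal_def sr_ideal_def)
  then show "M = N"
    using MN max_lifting_detect[OF assms] by (metis subset_antisym subset_iff)
qed

lemma hull_S_quot:
  assumes "csemiring S" "max_lifting S I" "a \<in> carrier S"
  shows "hull (S_quot S I) (pi_quot S I a) = (`) (pi_quot S I) ` (hull S a \<inter> V_max S I)"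
proof -
  have "hull (S_quot S I) (pi_quot S I a)
      = (`) (pi_quot S I) ` {M \<in> V_max S I. pi_quot S I a \<in> pi_quot S I ` M}"
    unfolding hull_def Max_ideals_S_quot[OF assms(1,2)] by blast
  also have "{M \<in> V_max S I. pi_quot S I a \<in> pi_quot S I ` M} = {M \<in> V_max S I. a \<in> M}"
    using max_lifting_detect[OF assms(2) _ assms(3)] by blast
  also have "\<dots> = hull S a \<inter> V_max S I"
    by (auto simp: hull_def V_max_def)
  finally show ?thesis .
qed

text \<open>Both hulls are direct images of subfamilies of \<open>V_max S I\<close>, and injectivity
  there cancels the direct image.\<close>

lemma hull_S_quot_eq_iff:
  assumes "csemiring S" "max_lifting S I" "a \<in> carrier S" "b \<in> carrier S"
  shows "hull (S_quot S I) (pi_quot S I a) = hull (S_quot S I) (pi_quot S I b)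
    \<longleftrightarrow> hull S a \<inter> V_max S I = hull S b \<inter> V_max S I"
  by (simp add: hull_S_quot assms inj_on_image_eq_iff[OF inj_on_V_max])

theorem theorem5p5:
  fixes S :: "('a, 'm) ring_scheme" and I J :: "'a set"
  assumes "csemiring S"
    and "sr_ideal I S" and "g_closed S I" and "max_lifting S I"
    and "sr_ideal J S" and "saturated S I J"
  shows "z_ideal (pi_quot S I ` J) (S_quot S I) \<longleftrightarrow> rel_z_ideal S I J"
proof -
  note pi = pi_quot_ring_hom[OF assms(1), of I]
  have J: "J \<subseteq> carrier S"
    using assms(5) by (simp add: sr_ideal_def)
  \<comment> \<open>Saturation enters here, in its form as equality of \<open>J\<close> with the
    preimage of its image.\<close>
  have mem: "pi_quot S I b \<in> pi_quot S I ` J \<longleftrightarrow> b \<in> J" if "b \<in> carrier S" for b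
    using that assms(6) saturated_iff[OF assms(1,5)] by blast
  \<comment> \<open>The ideal part of \<open>z_ideal\<close> holds outright, and surjectivity turns
    quantifiers over classes into quantifiers over representatives.\<close>
  have "z_ideal (pi_quot S I ` J) (S_quot S I) \<longleftrightarrow>
      (\<forall>a\<in>J. \<forall>b\<in>carrier S. hull (S_quot S I) (pi_quot S I a) = hull (S_quot S I) (pi_quot S I b)
        \<longrightarrow> pi_quot S I b \<in> pi_quot S I ` J)"
    using sr_ideal_image[OF pi assms(5)] unfolding z_ideal_def pi(2)[symmetric] by blast
  also have "\<dots> \<longleftrightarrow> (\<forall>a\<in>J. \<forall>b\<in>carrier S.
      hull S a \<inter> V_max S I = hull S b \<inter> V_max S I \<longrightarrow> b \<in> J)"
    using J mem hull_S_quot_eq_iff[OF assms(1,4)] by (simp add: subset_iff)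
  also have "\<dots> \<longleftrightarrow> rel_z_ideal S I J"
    using assms(5) by (simp add: rel_z_ideal_def)
  finally show ?thesis .
qed

end
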